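(* Let $N\in\mathbb{N}$. There exist finite dimensional Banach spaces $X_1,\ldots,X_N,Y$ such that $(X_1,\ldots,X_N;Y)$ has property $\mathbf{L}_{p,p}$ but fails the $\mathbf{BPBpp}$. Respectively, there exist finite dimensional Banach spaces $X_1,\ldots,X_N,Y$ such that $(X_1,\ldots,X_N;Y)$ has property $\mathbf{L}_{o,o}$ but fails the $\mathbf{BPBop}$.
   Context: Banach spaces are nonzero and over $\mathbb{K}=\mathbb{R}$ or $\mathbb{C}$; $S_X$ is the unit sphere of $X$. $\mathcal{L}(X_1,\ldots,X_N;Y)$ is the space of bounded $N$-linear maps $X_1\times\cdots\times X_N\to Y$, with $\|A\|=\sup\{\|A(x_1,\ldots,x_N)\|: x_i\in S_{X_i}\}$. Write $x=(x_1,\ldots,x_N)$, $S=S_{X_1}\times\cdots\times S_{X_N}$ and $\mathcal{L}=\mathcal{L}(X_1,\ldots,X_N;Y)$. $(X_1,\ldots,X_N;Y)$ has: - $\mathbf{BPBpp}$ if for every $\varepsilon>0$ there is $\eta(\varepsilon)>0$ such that whenever $A\in\mathcal{L}$, $\|A\|=1$ and $x\in S$ satisfy $\|A(x)\|>1-\eta(\varepsilon)$, there is $B\in\mathcal{L}$ with $\|B\|=1$, $\|B(x)\|=1$ and $\|B-A\|<\varepsilon$. - $\mathbf{BPBop}$ if for every $\varepsilon>0$ there is $\eta(\varepsilon)>0$ such that whenever $A\in\mathcal{L}$, $\|A\|=1$ and $x\in S$ satisfy $\|A(x)\|>1-\eta(\varepsilon)$, there is $z=(z_1,\ldots,z_N)\in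 S$ with $\|A(z)\|=1$ and $\max_j\|x_j-z_j\|<\varepsilon$. - $\mathbf{L}_{p,p}$ if for every $\varepsilon>0$ and $x\in S$ there is $\eta(\varepsilon,x)>0$ such that whenever $A\in\mathcal{L}$ with $\|A\|=1$ satisfies $\|A(x)\|>1-\eta(\varepsilon,x)$, there is $B\in\mathcal{L}$ with $\|B\|=1$, $\|B(x)\|=1$ and $\|B-A\|<\varepsilon$. - $\mathbf{L}_{o,o}$ if for every $\varepsilon>0$ and $A\in\mathcal{L}$ with $\|A\|=1$ there is $\eta(\varepsilon,A)>0$ such that whenever $x\in S$ satisfies $\|A(x)\|>1-\eta(\varepsilon,A)$, there is $z=(z_1,\ldots,z_N)\in S$ with $\|A(z)\|=1$ and $\max_j\|x_j-z_j\|<\varepsilon$. *)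

theory Defs
  imports "HOL-Analysis.Analysis" "HOL-Library.Function_Algebras"
begin

(* Banach spaces are subsets of a type rather than types, so that one can quantify over finite
   families of them.  The space is the linear subspace vecs X of the ambient type 'a; addition is
   that of 'a, and the values of nrm X outside vecs X are irrelevant.  The scalar field 'k is
   meant to be instantiated with real or complex. *)
record ('k, 'a) nspace =
  vecs :: "'a set"
  smul :: "'k \<Rightarrow> 'a \<Rightarrow> 'a"
  nrm  :: "'a \<Rightarrow> real"

definition normed_space :: "('k::real_normed_field, 'a::ab_group_add) nspace \<Rightarrow> bool" where
  "normed_space X \<longleftrightarrow>
     vector_space (smul X) \<and> module.subspace (smul X) (vecs X) \<and>
     (\<forall>u\<in>vecs X. 0 \<le> nrm X u \<and> (nrm X u = 0 \<longleftrightarrow> u = 0)) \<and>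
     (\<forall>c. \<forall>u\<in>vecs X. nrm X (smul X c u) = norm c * nrm X u) \<and>
     (\<forall>u\<in>vecs X. \<forall>v\<in>vecs X. nrm X (u + v) \<le> nrm X u + nrm X v)"

definition banach_space :: "('k::real_normed_field, 'a::ab_group_add) nspace \<Rightarrow> bool" where
  "banach_space X \<longleftrightarrow>
     normed_space X \<and> vecs X \<noteq> {0} \<and>
     Metric_space.mcomplete (vecs X) (\<lambda>u v. nrm X (u - v))"

definition finite_dim :: "('k::real_normed_field, 'a::ab_group_add) nspace \<Rightarrow> bool" where
  "finite_dim X \<longleftrightarrow> (\<exists>B. finite B \<and> B \<subseteq> vecs X \<and> module.span (smul X) B = vecs X)"

definition usphere :: "('k, 'a) nspace \<Rightarrow> 'a set" where
  "usphere X = {u \<in> vecs X. nrm X u = 1}"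

definition tuples :: "nat \<Rightarrow> (nat \<Rightarrow> ('k, 'a) nspace) \<Rightarrow> (nat \<Rightarrow> 'a) set" where
  "tuples N X = (\<Pi>\<^sub>E i\<in>{1..N}. vecs (X i))"

definition sphere_tuples :: "nat \<Rightarrow> (nat \<Rightarrow> ('k, 'a) nspace) \<Rightarrow> (nat \<Rightarrow> 'a) set" where
  "sphere_tuples N X = (\<Pi>\<^sub>E i\<in>{1..N}. usphere (X i))"

(* The values of the elements outside tuples N X are unconstrained; nothing below depends on
   them.  This makes the set closed under pointwise subtraction. *)
definition bdd_multilinear ::
  "nat \<Rightarrow> (nat \<Rightarrow> ('k, 'a::ab_group_add) nspace) \<Rightarrow> ('k, 'b::ab_group_add) nspace \<Rightarrow> ((nat \<Rightarrow> 'a) \<Rightarrow> 'b) set"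
where
  "bdd_multilinear N X Y = {A \<in> tuples N X \<rightarrow> vecs Y.
     (\<forall>x\<in>tuples N X. \<forall>i\<in>{1..N}. \<forall>u\<in>vecs (X i). \<forall>v\<in>vecs (X i).
        A (x(i := u + v)) = A (x(i := u)) + A (x(i := v))) \<and>
     (\<forall>x\<in>tuples N X. \<forall>i\<in>{1..N}. \<forall>c. \<forall>u\<in>vecs (X i).
        A (x(i := smul (X i) c u)) = smul Y c (A (x(i := u)))) \<and>
     (\<exists>C. \<forall>x\<in>tuples N X. nrm Y (A x) \<le> C * (\<Prod>i\<in>{1..N}. nrm (X i) (x i)))}"

definition mnorm ::
  "nat \<Rightarrow> (nat \<Rightarrow> ('k, 'a) nspace) \<Rightarrow> ('k, 'b) nspace \<Rightarrow> ((nat \<Rightarrow> 'a) \<Rightarrow> 'b) \<Rightarrow> real" where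
  "mnorm N X Y A = (SUP x\<in>sphere_tuples N X. nrm Y (A x))"

definition BPBpp ::
  "nat \<Rightarrow> (nat \<Rightarrow> ('k, 'a::ab_group_add) nspace) \<Rightarrow> ('k, 'b::ab_group_add) nspace \<Rightarrow> bool" where
  "BPBpp N X Y \<longleftrightarrow>
     (\<forall>\<epsilon>>0. \<exists>\<eta>>0. \<forall>A\<in>bdd_multilinear N X Y. \<forall>x\<in>sphere_tuples N X.
        mnorm N X Y A = 1 \<and> nrm Y (A x) > 1 - \<eta> \<longrightarrow>
        (\<exists>B\<in>bdd_multilinear N X Y.
           mnorm N X Y B = 1 \<and> nrm Y (B x) = 1 \<and> mnorm N X Y (B - A) < \<epsilon>))"

definition BPBop ::
  "nat \<Rightarrow> (nat \<Rightarrow> ('k, 'a::ab_group_add) nspace) \<Rightarrow> ('k, 'b::ab_group_add) nspace \<Rightarrow> bool" where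
  "BPBop N X Y \<longleftrightarrow>
     (\<forall>\<epsilon>>0. \<exists>\<eta>>0. \<forall>A\<in>bdd_multilinear N X Y. \<forall>x\<in>sphere_tuples N X.
        mnorm N X Y A = 1 \<and> nrm Y (A x) > 1 - \<eta> \<longrightarrow>
        (\<exists>z\<in>sphere_tuples N X.
           nrm Y (A z) = 1 \<and> Max ((\<lambda>j. nrm (X j) (x j - z j)) ` {1..N}) < \<epsilon>))"

definition L_pp ::
  "nat \<Rightarrow> (nat \<Rightarrow> ('k, 'a::ab_group_add) nspace) \<Rightarrow> ('k, 'b::ab_group_add) nspace \<Rightarrow> bool" where
  "L_pp N X Y \<longleftrightarrow>
     (\<forall>\<epsilon>>0. \<forall>x\<in>sphere_tuples N X. \<exists>\<eta>>0. \<forall>A\<in>bdd_multilinear N X Y.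
        mnorm N X Y A = 1 \<and> nrm Y (A x) > 1 - \<eta> \<longrightarrow>
        (\<exists>B\<in>bdd_multilinear N X Y.
           mnorm N X Y B = 1 \<and> nrm Y (B x) = 1 \<and> mnorm N X Y (B - A) < \<epsilon>))"

definition L_oo ::
  "nat \<Rightarrow> (nat \<Rightarrow> ('k, 'a::ab_group_add) nspace) \<Rightarrow> ('k, 'b::ab_group_add) nspace \<Rightarrow> bool" where
  "L_oo N X Y \<longleftrightarrow>
     (\<forall>\<epsilon>>0. \<forall>A\<in>bdd_multilinear N X Y. mnorm N X Y A = 1 \<longrightarrow>
        (\<exists>\<eta>>0. \<forall>x\<in>sphere_tuples N X. nrm Y (A x) > 1 - \<eta> \<longrightarrow>
          (\<exists>z\<in>sphere_tuples N X.
             nrm Y (A z) = 1 \<and> Max ((\<lambda>j. nrm (X j) (x j - z j)) ` {1..N}) < \<epsilon>)))"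

definition fd_banach_spaces ::
  "nat \<Rightarrow> (nat \<Rightarrow> ('k::real_normed_field, 'a::ab_group_add) nspace) \<Rightarrow>
   ('k, 'b::ab_group_add) nspace \<Rightarrow> bool" where
  "fd_banach_spaces N X Y \<longleftrightarrow>
     (\<forall>i\<in>{1..N}. banach_space (X i) \<and> finite_dim (X i)) \<and> banach_space Y \<and> finite_dim Y"

end

theory Submission
  imports Defs
begin

text \<open>
  Take \<open>X\<^sub>1\<close> to be the plane with the \<open>\<ell>\<^sub>1\<close> norm and all other spaces to be the scalar field. Every
  multilinear form is then \<open>x \<mapsto> (a\<^sub>0 x\<^sub>1(0) + a\<^sub>1 x\<^sub>1(1)) \<cdot> x\<^sub>2 \<cdots> x\<^sub>N\<close>, with norm
  \<open>max |a\<^sub>0| |a\<^sub>1|\<close>. The local properties follow from compactness of the unit spheres, while the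
  uniform ones fail with \<open>\<epsilon> = 1\<close>: the form \<open>(1, 0)\<close> almost attains its norm at \<open>(1 - \<delta>, \<delta>)\<close>, but a
  form of norm one attaining its norm there has \<open>|a\<^sub>1| = 1\<close>; and the form \<open>(1, 1 - \<delta>)\<close> almost attains
  its norm at \<open>(0, 1)\<close>, but attains it only at points with vanishing second coordinate.
\<close>

section \<open>Finite-dimensional l1 spaces as Banach spaces\<close>

text \<open>Sequences supported below \<open>d\<close> put every dimension into one ambient type, so
  that factors of different dimensions can form a single family. For \<open>d = 1\<close> this is
  the scalar field, stored in coordinate 0.\<close>

definition ell1 :: "nat \<Rightarrow> ('k::real_normed_field, nat \<Rightarrow> 'k) nspace" where
  "ell1 d = \<lparr>vecs = {f. \<forall>n\<ge>d. f n = 0}, smul = (\<lambda>c f n. c * f n), nrm = (\<lambda>f. \<Sum>n<d. norm (f n))\<rparr>"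

lemma vecs_ell1 [simp]: "u \<in> vecs (ell1 d) \<longleftrightarrow> (\<forall>n\<ge>d. u n = 0)"
  and smul_ell1 [simp]: "smul (ell1 d) c u = (\<lambda>n. c * u n)"
  and nrm_ell1: "nrm (ell1 d) u = (\<Sum>n<d. norm (u n))"
  by (simp_all add: ell1_def)

lemma nrm_ell1_1 [simp]: "nrm (ell1 (Suc 0)) u = norm (u 0)"
  by (simp add: nrm_ell1)

lemma nrm_ell1_2 [simp]: "nrm (ell1 2) u = norm (u 0) + norm (u 1)"
  by (simp add: nrm_ell1 eval_nat_numeral)

lemma nrm_ell1_eq_0_iff:
  assumes "u \<in> vecs (ell1 d)"
  shows "nrm (ell1 d) u = 0 \<longleftrightarrow> u = 0"
proof -
  have "nrm (ell1 d) u = 0 \<longleftrightarrow> (\<forall>n<d. u n = 0)"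
    by (auto simp: nrm_ell1 sum_nonneg_eq_0_iff)
  also have "\<dots> \<longleftrightarrow> u = 0"
    using assms by (auto simp: fun_eq_iff) (meson leI)
  finally show ?thesis .
qed

lemma vector_space_ell1: "vector_space (smul (ell1 d))"
  by unfold_locales (auto simp: fun_eq_iff algebra_simps)

lemma normed_space_ell1: "normed_space (ell1 d :: ('k::real_normed_field, _) nspace)"
proof -
  interpret vector_space "smul (ell1 d) :: 'k \<Rightarrow> _"
    by (rule vector_space_ell1)
  have "subspace (vecs (ell1 d :: ('k, _) nspace))"
    unfolding subspace_def by simp
  then show ?thesis
    unfolding normed_space_def
    by (auto simp: vector_space_ell1 nrm_ell1_eq_0_iff)
       (auto simp: nrm_ell1 sum_nonneg norm_mult sum_distrib_left
        sum.distrib [symmetric] intro!: sum_mono norm_triangle_ineq)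
qed

lemma finite_dim_ell1: "finite_dim (ell1 d :: ('k::real_normed_field, _) nspace)"
proof -
  interpret vector_space "smul (ell1 d) :: 'k \<Rightarrow> _"
    by (rule vector_space_ell1)
  define e :: "nat \<Rightarrow> nat \<Rightarrow> 'k" where "e k = (\<lambda>n. if n = k then 1 else 0)" for k
  have sub: "e ` {..<d} \<subseteq> vecs (ell1 d)"
    by (auto simp: e_def)
  have "u \<in> span (e ` {..<d})" if "u \<in> vecs (ell1 d)" for u
  proof -
    have sum_app: "(\<Sum>k\<in>K. g k) n = (\<Sum>k\<in>K. g k n)" for g :: "nat \<Rightarrow> nat \<Rightarrow> 'k" and K n
      by (induction K rule: infinite_finite_induct) auto
    have "u = (\<Sum>k<d. smul (ell1 d) (u k) (e k))"
    proof
      fix n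
      have "(\<Sum>k<d. u k * e k n) = (\<Sum>k<d. if k = n then u k else 0)"
        by (intro sum.cong) (auto simp: e_def)
      then show "u n = (\<Sum>k<d. smul (ell1 d) (u k) (e k)) n"
        using that by (auto simp: sum_app sum.delta)
    qed
    also have "\<dots> \<in> span (e ` {..<d})"
      by (intro span_sum span_scale span_base) auto
    finally show ?thesis .
  qed
  moreover have "subspace (vecs (ell1 d :: ('k, _) nspace))"
    unfolding subspace_def by simp
  ultimately have "span (e ` {..<d}) = vecs (ell1 d)"
    using span_minimal [OF sub] by blast
  with sub show ?thesis
    unfolding finite_dim_def by blast
qed

text \<open>The coordinates of a Cauchy sequence are Cauchy in the complete field; since they are
  finitely many, their limits give a limit in the norm.\<close>

lemma mcomplete_ell1:
  "Metric_space.mcomplete (vecs (ell1 d)) (\<lambda>u v. nrm (ell1 d) (u - v :: nat \<Rightarrow> 'k::{real_normed_field, complete_space}))"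
proof -
  let ?V = "vecs (ell1 d) :: (nat \<Rightarrow> 'k) set" and ?d = "\<lambda>u v :: nat \<Rightarrow> 'k. nrm (ell1 d) (u - v)"
  interpret Metric_space ?V ?d
  proof
    fix u v w :: "nat \<Rightarrow> 'k"
    show "0 \<le> ?d u v"
      by (simp add: nrm_ell1 sum_nonneg)
    show "?d u v = ?d v u"
      by (simp add: nrm_ell1 norm_minus_commute)
    show "?d u v = 0 \<longleftrightarrow> u = v" if "u \<in> ?V" "v \<in> ?V"
      using nrm_ell1_eq_0_iff [of "u - v" d] that by simp
    show "?d u w \<le> ?d u v + ?d v w"
      unfolding nrm_ell1 sum.distrib [symmetric]
    proof (rule sum_mono)
      show "norm ((u - w) n) \<le> norm ((u - v) n) + norm ((v - w) n)" for n
        using norm_triangle_ineq [of "u n - v n" "v n - w n"] by simp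
    qed
  qed
  show ?thesis
    unfolding mcomplete_def
  proof (intro allI impI)
    fix s assume s: "MCauchy s"
    have "Cauchy (\<lambda>m. s m n)" if "n < d" for n
    proof (rule metric_CauchyI)
      fix e :: real assume "0 < e"
      then obtain M where M: "\<And>m m'. M \<le> m \<Longrightarrow> M \<le> m' \<Longrightarrow> ?d (s m) (s m') < e"
        using s [unfolded MCauchy_def, THEN conjunct2, rule_format, OF \<open>0 < e\<close>] by blast
      have "dist (s m n) (s m' n) < e" if "M \<le> m" "M \<le> m'" for m m'
      proof -
        have "norm (s m n - s m' n) \<le> ?d (s m) (s m')"
          using member_le_sum [of n "{..<d}" "\<lambda>n. norm (s m n - s m' n)"] \<open>n < d\<close>
          by (simp add: nrm_ell1)
        with M [OF that] show ?thesis
          by (simp add: dist_norm)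
      qed
      then show "\<exists>M. \<forall>m\<ge>M. \<forall>m'\<ge>M. dist (s m n) (s m' n) < e" by blast
    qed
    then have "\<forall>n. \<exists>l. n < d \<longrightarrow> (\<lambda>m. s m n) \<longlonglongrightarrow> l"
      using Cauchy_convergent convergent_def by blast
    then obtain l where l: "\<And>n. n < d \<Longrightarrow> (\<lambda>m. s m n) \<longlonglongrightarrow> l n"
      by metis
    \<comment> \<open>\<open>l\<close> is unspecified from \<open>d\<close> on; cutting it off there
      yields an element of the space.\<close>
    define l' where "l' n = (if n < d then l n else 0)" for n
    have "(\<lambda>m. ?d (s m) l') \<longlonglongrightarrow> (\<Sum>n<d. norm (l n - l n))"
      unfolding nrm_ell1
    proof (intro tendsto_sum)
      fix n assume "n \<in> {..<d}"
      then show "(\<lambda>m. norm ((s m - l') n)) \<longlonglongrightarrow> norm (l n - l n)"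
        using tendsto_norm [OF tendsto_diff [OF l tendsto_const], of n "l n"] by (simp add: l'_def)
    qed
    then have "\<And>e. 0 < e \<Longrightarrow> \<exists>M. \<forall>m\<ge>M. ?d (s m) l' < e"
      by (simp add: LIMSEQ_iff)
    moreover have "s m \<in> ?V" for m
      using s range_subsetD unfolding MCauchy_def by metis
    moreover have "l' \<in> ?V"
      by (simp add: l'_def)
    ultimately show "\<exists>x. limitin mtopology s x sequentially"
      unfolding limit_metric_sequentially by (intro exI [of _ l'] conjI allI impI) simp_all
  qed
qed

lemma banach_space_ell1:
  assumes "0 < d"
  shows "banach_space (ell1 d :: ('k::{real_normed_field, complete_space}, _) nspace)"
proof -
  define e :: "nat \<Rightarrow> 'k" where "e = (\<lambda>n. if n = 0 then 1 else 0)"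
  have "e \<in> vecs (ell1 d)" "e \<noteq> 0"
    using assms by (auto simp: e_def fun_eq_iff)
  then show ?thesis
    unfolding banach_space_def using normed_space_ell1 mcomplete_ell1 by blast
qed

section \<open>The chosen factors and the forms with given coefficients\<close>

definition factors :: "nat \<Rightarrow> ('k::real_normed_field, nat \<Rightarrow> 'k) nspace" where
  "factors i = ell1 (if i = 1 then 2 else 1)"

lemma fd_banach_spaces_factors:
  "fd_banach_spaces N factors (ell1 1 :: ('k::{real_normed_field, complete_space}, _) nspace)"
  by (auto simp: fd_banach_spaces_def factors_def banach_space_ell1 finite_dim_ell1)

lemma factors_1 [simp]: "factors (Suc 0) = ell1 2"
  and factors_neq_1 [simp]: "i \<noteq> 1 \<Longrightarrow> factors i = ell1 1"
  by (simp_all add: factors_def)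

lemma smul_factors: "smul (factors i) c u = (\<lambda>n. c * u n)"
  by (simp add: factors_def)

definition coform :: "'k::real_normed_field \<times> 'k \<Rightarrow> 'k \<times> 'k \<Rightarrow> 'k" where
  "coform a p = fst a * fst p + snd a * snd p"

definition head :: "(nat \<Rightarrow> nat \<Rightarrow> 'k) \<Rightarrow> 'k \<times> 'k" where
  "head x = (x 1 0, x 1 1)"

text \<open>The scalar value sits in coordinate 0 because the target is \<open>ell1 1\<close>. For
  \<open>N = 1\<close> the product is empty and a linear functional on the plane remains.\<close>

definition form :: "nat \<Rightarrow> 'k::real_normed_field \<times> 'k \<Rightarrow> (nat \<Rightarrow> nat \<Rightarrow> 'k) \<Rightarrow> nat \<Rightarrow> 'k" where
  "form N a x = (\<lambda>n. if n = 0 then (\<Prod>i\<in>{2..N}. x i 0) * coform a (head x) else 0)"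

text \<open>This is the norm dual to \<open>sumnorm\<close>. Both are functions on plain pairs, so
  that the product topology of the pair type supplies continuity and compactness.\<close>

definition maxnorm :: "'k::real_normed_field \<times> 'k \<Rightarrow> real" where
  "maxnorm a = max (norm (fst a)) (norm (snd a))"

definition sumnorm :: "'k::real_normed_field \<times> 'k \<Rightarrow> real" where
  "sumnorm p = norm (fst p) + norm (snd p)"

text \<open>Unlike the duality bound that follows from it, this estimate keeps the two coordinates
  apart; the counterexamples gain strictness in the second one alone.\<close>

lemma norm_coform_triangle: "norm (coform a p) \<le> norm (fst a) * norm (fst p) + norm (snd a) * norm (snd p)"
  unfolding coform_def by (metis norm_mult norm_triangle_ineq)

lemma norm_coform_le: "norm (coform a p) \<le> maxnorm a * sumnorm p"
proof -
  have "norm (coform a p) \<le> norm (fst a) * norm (fst p) + norm (snd a) * norm (snd p)"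
    by (rule norm_coform_triangle)
  also have "\<dots> \<le> maxnorm a * norm (fst p) + maxnorm a * norm (snd p)"
    by (intro add_mono mult_right_mono) (auto simp: maxnorm_def)
  finally show ?thesis
    by (simp add: sumnorm_def distrib_left)
qed

lemma atLeastAtMost_1: "1 \<le> N \<Longrightarrow> {1..N} = insert 1 {2..N::nat}"
  by auto

text \<open>A right inverse of \<open>head\<close>: the scalar slots hold 1, so the product in
  \<open>form\<close> is 1. The restriction to \<open>{1..N}\<close> provides the extensionality
  that \<open>sphere_tuples\<close> requires.\<close>

definition tuple :: "nat \<Rightarrow> 'k::real_normed_field \<times> 'k \<Rightarrow> nat \<Rightarrow> nat \<Rightarrow> 'k" where
  "tuple N p = (\<lambda>i\<in>{1..N}. if i = 1 then (\<lambda>n. if n = 0 then fst p else if n = 1 then snd p else 0)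
                           else (\<lambda>n. if n = 0 then 1 else 0))"

lemma sphere_tuplesD:
  assumes "x \<in> sphere_tuples N factors" "1 \<le> N"
  shows "sumnorm (head x) = 1" "\<And>i. i \<in> {2..N} \<Longrightarrow> norm (x i 0) = 1" "x \<in> tuples N factors"
proof -
  have x: "x i \<in> usphere (factors i)" if "i \<in> {1..N}" for i
    using assms that by (auto simp: sphere_tuples_def PiE_iff)
  show "sumnorm (head x) = 1"
    using x [of 1] assms by (simp add: usphere_def sumnorm_def head_def)
  show "norm (x i 0) = 1" if "i \<in> {2..N}" for i
    using x [of i] that by (simp add: usphere_def)
  show "x \<in> tuples N factors"
    using assms by (auto simp: sphere_tuples_def tuples_def PiE_iff usphere_def)
qed

lemma head_tuple: "1 \<le> N \<Longrightarrow> head (tuple N p) = p"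
  by (simp add: head_def tuple_def)

lemma tuple_in_sphere_tuples: "sumnorm p = 1 \<Longrightarrow> tuple N p \<in> sphere_tuples N factors"
  by (auto simp: sphere_tuples_def tuple_def usphere_def sumnorm_def)

text \<open>On the spheres the scalar entries have modulus one, so their product does not affect the
  norm. Norm questions about forms thus become questions about two pairs.\<close>

lemma nrm_form:
  assumes "x \<in> sphere_tuples N factors" "1 \<le> N"
  shows "nrm (ell1 1) (form N a x) = norm (coform a (head x))"
  using sphere_tuplesD(2) [OF assms]
  by (simp add: form_def norm_mult prod_norm [symmetric])

section \<open>Bounded multilinear maps and their norms in terms of coefficients\<close>

lemma form_bdd_multilinear:
  assumes "1 \<le> N"
  shows "form N (a :: 'k::real_normed_field \<times> 'k) \<in> bdd_multilinear N factors (ell1 1)"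
proof -
  note I = atLeastAtMost_1 [OF assms]
  \<comment> \<open>Isolating the entry of slot \<open>i\<close> makes linearity in it visible. Slot
    1 enters through \<open>head\<close> instead of the product and gets its own formula
    \<open>upd_1\<close>.\<close>
  have upd: "form N a (x(i := w)) =
      (\<lambda>n. if n = 0 then w 0 * ((\<Prod>k\<in>{2..N}-{i}. x k 0) * coform a (head x)) else 0)"
    if "i \<in> {2..N}" for x i w
  proof -
    have "(\<Prod>k\<in>{2..N}. (x(i := w)) k 0) = w 0 * (\<Prod>k\<in>{2..N}-{i}. x k 0)"
      using that by (subst prod.remove [of _ i]) (auto intro!: prod.cong)
    moreover have "head (x(i := w)) = head x"
      using that by (simp add: head_def)
    ultimately show ?thesis
      unfolding form_def by (simp only: mult.assoc)
  qed
  have upd_1: "form N a (x(1 := w)) =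
      (\<lambda>n. if n = 0 then (\<Prod>k\<in>{2..N}. x k 0) * coform a (w 0, w 1) else 0)" for x w
  proof -
    have "(\<Prod>k\<in>{2..N}. (x(1 := w)) k 0) = (\<Prod>k\<in>{2..N}. x k 0)"
      by (intro prod.cong) auto
    moreover have "head (x(1 := w)) = (w 0, w 1)"
      by (simp add: head_def)
    ultimately show ?thesis
      unfolding form_def by (simp only:)
  qed
  have add: "form N a (x(i := u + v)) = form N a (x(i := u)) + form N a (x(i := v))"
    and scale: "form N a (x(i := (\<lambda>n. c * u n))) = (\<lambda>n. c * form N a (x(i := u)) n)"
    if "i \<in> {1..N}" for x i u v c
    using that unfolding I
    by (auto simp only: insert_iff upd upd_1) (auto simp: fun_eq_iff coform_def algebra_simps)
  have bound: "nrm (ell1 1) (form N a x) \<le> maxnorm a * (\<Prod>i\<in>{1..N}. nrm (factors i) (x i))" for x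
  proof -
    have "(\<Prod>i\<in>{1..N}. nrm (factors i) (x i)) = sumnorm (head x) * (\<Prod>i\<in>{2..N}. norm (x i 0))"
      unfolding I by (subst prod.insert) (auto simp: sumnorm_def head_def intro!: prod.cong)
    moreover have "(\<Prod>i\<in>{2..N}. norm (x i 0)) * norm (coform a (head x))
        \<le> (\<Prod>i\<in>{2..N}. norm (x i 0)) * (maxnorm a * sumnorm (head x))"
      by (intro mult_left_mono norm_coform_le prod_nonneg) auto
    ultimately show ?thesis
      by (simp add: form_def norm_mult prod_norm [symmetric] mult_ac)
  qed
  have vecs: "form N a x \<in> vecs (ell1 1)" for x
    by (auto simp: form_def)
  show ?thesis
    unfolding bdd_multilinear_def mem_Collect_eq
    by (intro conjI ballI allI funcsetI exI [of _ "maxnorm a"])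
       (simp_all only: smul_factors smul_ell1 add scale bound vecs)
qed

text \<open>Homogeneity pulls the scalar out of each slot from 2 on, and the first vector is
  expanded in the standard basis; the coefficients are the values of \<open>A\<close> at the two
  basis tuples. The equality is confined to \<open>tuples\<close>, outside of which \<open>A\<close>
  is arbitrary.\<close>

lemma bdd_multilinear_eq_form:
  assumes A: "A \<in> bdd_multilinear N factors (ell1 1 :: ('k::real_normed_field, _) nspace)" and "1 \<le> N"
  obtains a where "\<And>x. x \<in> tuples N factors \<Longrightarrow> A x = form N a x"
proof
  let ?e = "\<lambda>n. if n = 0 then 1 else 0 :: 'k"
  have add: "A (x(i := u + v)) = A (x(i := u)) + A (x(i := v))"
    if "x \<in> tuples N factors" "i \<in> {1..N}" "u \<in> vecs (factors i)" "v \<in> vecs (factors i)" for x i u v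
    using A that unfolding bdd_multilinear_def by blast
  have scale: "A (x(i := (\<lambda>n. c * u n))) = (\<lambda>n. c * A (x(i := u)) n)"
    if "x \<in> tuples N factors" "i \<in> {1..N}" "u \<in> vecs (factors i)" for x i u c
    using A that unfolding bdd_multilinear_def mem_Collect_eq smul_factors smul_ell1 by blast
  fix x :: "nat \<Rightarrow> nat \<Rightarrow> 'k" assume x: "x \<in> tuples N factors"
  then have xi: "x i \<in> vecs (factors i)" if "i \<in> {1..N}" for i
    using that unfolding tuples_def by (rule PiE_mem)
  \<comment> \<open>These tuples, with unit entries in the slots of \<open>I\<close>, are the
    intermediate stages of the reduction.\<close>
  have y: "(\<lambda>i. if i \<in> I then ?e else x i) \<in> tuples N factors" if I: "I \<subseteq> {2..N}" for I
    unfolding tuples_def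
  proof (rule PiE_I)
    fix i assume i: "i \<in> {1..N}"
    show "(if i \<in> I then ?e else x i) \<in> vecs (factors i)"
    proof (cases "i \<in> I")
      case True
      then have "i \<noteq> 1"
        using I by auto
      with True show ?thesis by simp
    qed (simp add: xi [OF i] del: vecs_ell1)
  next
    fix i assume i: "i \<notin> {1..N}"
    then have "i \<notin> I"
      using I by auto
    moreover have "x i = undefined"
      using x i unfolding tuples_def by (rule PiE_arb)
    ultimately show "(if i \<in> I then ?e else x i) = undefined"
      by simp
  qed
  have x0: "(\<lambda>n. x i 0 * ?e n) = x i" if "i \<in> {2..N}" for i
    using xi [of i] that by (auto simp: fun_eq_iff)
  have reduce: "A x = (\<lambda>n. (\<Prod>i\<in>I. x i 0) * A (\<lambda>i. if i \<in> I then ?e else x i) n)"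
    if "finite I" "I \<subseteq> {2..N}" for I
    using that
  proof induction
    case (insert j I)
    let ?y = "\<lambda>i. if i \<in> I then ?e else x i"
    have "j \<in> {2..N}"
      using insert.prems by simp
    \<comment> \<open>As \<open>j\<close> is not in \<open>I\<close>, slot \<open>j\<close> still
      holds \<open>x j\<close>; writing it as \<open>x j 0\<close> times the unit lets homogeneity
      act.\<close>
    from x0 [OF this] have "A ?y = A (?y(j := (\<lambda>n. x j 0 * ?e n)))"
      using insert.hyps by (simp only: if_False fun_upd_idem)
    also have "\<dots> = (\<lambda>n. x j 0 * A (?y(j := ?e)) n)"
      using insert.prems by (intro scale y) auto
    also have "?y(j := ?e) = (\<lambda>i. if i \<in> insert j I then ?e else x i)"
      by (auto simp: fun_eq_iff)
    finally show ?case
      using insert.IH insert.hyps insert.prems by (simp add: mult_ac)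
  qed auto
  let ?y = "\<lambda>i. if i \<in> {2..N} then ?e else x i"
  \<comment> \<open>The standard basis of the plane, written in the shape of the first entry of
    \<open>tuple\<close>.\<close>
  let ?u = "\<lambda>n. if n = 0 then 1 else if n = 1 then 0 else 0 :: 'k"
  let ?v = "\<lambda>n. if n = 0 then 0 else if n = 1 then 1 else 0 :: 'k"
  have tuple: "?y(1 := ?u) = tuple N (1, 0)" "?y(1 := ?v) = tuple N (0, 1)"
    using x \<open>1 \<le> N\<close> by (auto simp: tuple_def tuples_def PiE_iff extensional_def fun_eq_iff)
  have N1: "1 \<in> {1..N}"
    using \<open>1 \<le> N\<close> by simp
  have uv: "?u \<in> vecs (factors 1)" "?v \<in> vecs (factors 1)"
    by auto
  have x1: "(\<lambda>n. x 1 0 * ?u n) + (\<lambda>n. x 1 1 * ?v n) = x 1"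
    using xi [OF N1] by (auto simp: fun_eq_iff)
  have upd: "?y(1 := x 1) = ?y"
    by (simp add: fun_eq_iff)
  have "A ?y = A (?y(1 := (\<lambda>n. x 1 0 * ?u n) + (\<lambda>n. x 1 1 * ?v n)))"
    unfolding x1 upd ..
  also have "\<dots> = A (?y(1 := (\<lambda>n. x 1 0 * ?u n))) + A (?y(1 := (\<lambda>n. x 1 1 * ?v n)))"
    by (intro add y N1 subset_refl) auto
  also have "\<dots> = (\<lambda>n. x 1 0 * A (tuple N (1, 0)) n) + (\<lambda>n. x 1 1 * A (tuple N (0, 1)) n)"
    unfolding scale [OF y [OF subset_refl] N1 uv(1)] scale [OF y [OF subset_refl] N1 uv(2)] tuple ..
  finally have *: "A x = (\<lambda>n. (\<Prod>i\<in>{2..N}. x i 0) *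
      (x 1 0 * A (tuple N (1, 0)) n + x 1 1 * A (tuple N (0, 1)) n))"
    by (subst reduce [of "{2..N}"]) (simp_all only: plus_fun_apply finite_atLeastAtMost subset_refl)
  \<comment> \<open>Membership in \<open>ell1 1\<close> kills all coordinates but 0, so it remains
    to compare coordinate 0.\<close>
  have "A x \<in> vecs (ell1 1)"
    using A x unfolding bdd_multilinear_def by blast
  then have "A x n = 0" if "n \<noteq> 0" for n
    using that by simp
  moreover have "A x 0 = form N (A (tuple N (1, 0)) 0, A (tuple N (0, 1)) 0) x 0"
    unfolding * by (simp add: form_def coform_def head_def mult.commute)
  ultimately show "A x = form N (A (tuple N (1, 0)) 0, A (tuple N (0, 1)) 0) x"
    unfolding form_def by (intro ext) (metis (full_types))
qed

text \<open>The duality bound gives one inequality, and the two basis tuples realise the moduli of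
  the two coefficients. Agreement on sphere tuples is enough, so the lemma also covers differences
  such as \<open>form N b - A\<close>.\<close>

lemma mnorm_eq_maxnorm:
  assumes "1 \<le> N" and A: "\<And>x. x \<in> sphere_tuples N factors \<Longrightarrow> A x = form N a x"
  shows "mnorm N factors (ell1 1) A = maxnorm (a :: 'k::real_normed_field \<times> 'k)"
  unfolding mnorm_def
proof (rule antisym)
  have le: "nrm (ell1 1) (A x) \<le> maxnorm a" if "x \<in> sphere_tuples N factors" for x
    using norm_coform_le [of a "head x"] sphere_tuplesD(1) [OF that \<open>1 \<le> N\<close>]
    by (simp only: A [OF that] nrm_form [OF that \<open>1 \<le> N\<close>] mult_1_right)
  have s: "tuple N (1, 0) \<in> sphere_tuples N factors" "tuple N (0, 1) \<in> sphere_tuples N factors"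
    by (auto intro!: tuple_in_sphere_tuples simp: sumnorm_def)
  show "(SUP x\<in>sphere_tuples N factors. nrm (ell1 1) (A x)) \<le> maxnorm a"
    using s le by (intro cSUP_least) auto
  have bdd: "bdd_above ((\<lambda>x. nrm (ell1 1) (A x)) ` sphere_tuples N factors)"
    using le by (rule bdd_aboveI2)
  have "norm (fst a) = nrm (ell1 1) (A (tuple N (1, 0)))"
    "norm (snd a) = nrm (ell1 1) (A (tuple N (0, 1)))"
    by (simp_all only: A s nrm_form [OF _ \<open>1 \<le> N\<close>] head_tuple \<open>1 \<le> N\<close>) (simp_all add: coform_def)
  then show "maxnorm a \<le> (SUP x\<in>sphere_tuples N factors. nrm (ell1 1) (A x))"
    using cSUP_upper [OF s(1) bdd] cSUP_upper [OF s(2) bdd] by (simp add: maxnorm_def)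
qed

lemma form_diff: "form N a - form N b = form N (a - b)"
  by (auto simp: form_def fun_eq_iff coform_def algebra_simps)

section \<open>The local properties by compactness\<close>

text \<open>The points of \<open>S\<close> at distance at least \<epsilon> from
  \<open>{b\<in>S. 1 \<le> f b}\<close> form a compact set \<open>T\<close> on which
  \<open>f < 1\<close>. If \<open>T\<close> is nonempty, the gap between 1 and the maximum of
  \<open>f\<close> on \<open>T\<close> serves as \<eta>.\<close>

lemma compact_near_max:
  fixes f :: "'a::metric_space \<Rightarrow> real"
  assumes "compact S" "continuous_on S f" "0 < \<epsilon>"
  obtains \<eta> where "0 < \<eta>" "\<And>a. a \<in> S \<Longrightarrow> 1 - \<eta> < f a \<Longrightarrow> \<exists>b\<in>S. 1 \<le> f b \<and> dist a b < \<epsilon>"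
proof -
  define T where "T = S - (\<Union>b\<in>{b\<in>S. 1 \<le> f b}. ball b \<epsilon>)"
  have lt: "f a < 1" if "a \<in> T" for a
    using that \<open>0 < \<epsilon>\<close> by (force simp: T_def)
  have near: "\<exists>b\<in>S. 1 \<le> f b \<and> dist a b < \<epsilon>" if "a \<in> S" "a \<notin> T" for a
    using that by (auto simp: T_def dist_commute)
  show ?thesis
  proof (cases "T = {}")
    case True
    with near show ?thesis
      by (intro that [of 1]) auto
  next
    case False
    have "compact T"
      unfolding T_def using assms by (intro compact_diff) auto
    moreover have "continuous_on T f"
      using assms(2) by (rule continuous_on_subset) (auto simp: T_def)
    ultimately obtain m where "m \<in> T" "\<And>a. a \<in> T \<Longrightarrow> f a \<le> f m"
      using continuous_attains_sup [OF _ False] by blast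
    with lt near show ?thesis
      by (intro that [of "1 - f m"]) (auto simp: not_less [symmetric])
  qed
qed

text \<open>Compactness yields distances in the product norm of the pair type; these comparisons
  translate them into the norms of the forms and of the plane, and bound the unit spheres.\<close>

lemma norm_le_maxnorm_sumnorm:
  fixes p :: "'k::real_normed_field \<times> 'k"
  shows "maxnorm p \<le> norm p" "sumnorm p \<le> 2 * norm p" "norm p \<le> 2 * maxnorm p" "maxnorm p \<le> sumnorm p"
  using norm_fst_le [of "fst p" "snd p"] norm_snd_le [of "snd p" "fst p"] norm_Pair_le [of "fst p" "snd p"]
  by (auto simp: maxnorm_def sumnorm_def)

lemma compact_spheres:
  "compact {a :: 'k::{real_normed_field, heine_borel} \<times> 'k. maxnorm a = 1}"
  "compact {p :: 'k \<times> 'k. sumnorm p = 1}"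
proof -
  have bnd: "norm a \<le> 2" if "maxnorm a = 1 \<or> sumnorm a = 1" for a :: "'k \<times> 'k"
    using that norm_le_maxnorm_sumnorm(3,4) [of a] by linarith
  show "compact {a :: 'k \<times> 'k. maxnorm a = 1}"
    unfolding compact_eq_bounded_closed bounded_iff
    by (intro conjI closed_Collect_eq exI [of _ 2]) (auto simp: bnd maxnorm_def intro!: continuous_intros)
  show "compact {a :: 'k \<times> 'k. sumnorm a = 1}"
    unfolding compact_eq_bounded_closed bounded_iff
    by (intro conjI closed_Collect_eq exI [of _ 2]) (auto simp: bnd sumnorm_def intro!: continuous_intros)
qed

text \<open>For fixed \<open>x\<close>, the value at \<open>x\<close> is a continuous function of
  the coefficients, which range over the compact \<open>maxnorm\<close> sphere. That function varies
  with \<open>x\<close>, and \<eta> with it.\<close>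

lemma L_pp_factors:
  assumes "1 \<le> N"
  shows "L_pp N factors (ell1 1 :: ('k::{real_normed_field, heine_borel}, _) nspace)"
  unfolding L_pp_def
proof (intro allI ballI impI)
  fix \<epsilon> :: real and x :: "nat \<Rightarrow> nat \<Rightarrow> 'k"
  assume "0 < \<epsilon>" and x: "x \<in> sphere_tuples N factors"
  have "continuous_on S (\<lambda>a. norm (coform a (head x)))" for S
    by (auto simp: coform_def intro!: continuous_intros)
  from compact_near_max [OF compact_spheres(1) this \<open>0 < \<epsilon>\<close>]
  obtain \<eta> where "0 < \<eta>" and \<eta>: "\<And>a. maxnorm a = 1 \<Longrightarrow> 1 - \<eta> < norm (coform a (head x)) \<Longrightarrow>
      \<exists>b. maxnorm b = 1 \<and> 1 \<le> norm (coform b (head x)) \<and> dist a b < \<epsilon>"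
    by auto
  show "\<exists>\<eta>>0. \<forall>A\<in>bdd_multilinear N factors (ell1 1).
      mnorm N factors (ell1 1) A = 1 \<and> 1 - \<eta> < nrm (ell1 1) (A x) \<longrightarrow>
      (\<exists>B\<in>bdd_multilinear N factors (ell1 1). mnorm N factors (ell1 1) B = 1 \<and>
          nrm (ell1 1) (B x) = 1 \<and> mnorm N factors (ell1 1) (B - A) < \<epsilon>)"
  proof (intro exI [of _ \<eta>] conjI ballI impI \<open>0 < \<eta>\<close>)
    fix A assume A: "A \<in> bdd_multilinear N factors (ell1 1 :: ('k, _) nspace)"
      and A1: "mnorm N factors (ell1 1) A = 1 \<and> 1 - \<eta> < nrm (ell1 1) (A x)"
    obtain a where "\<And>x. x \<in> tuples N factors \<Longrightarrow> A x = form N a x"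
      by (rule bdd_multilinear_eq_form [OF A assms]) blast
    then have a: "A x = form N a x" if "x \<in> sphere_tuples N factors" for x
      using sphere_tuplesD(3) [OF that assms] by blast
    have "maxnorm a = 1" "1 - \<eta> < norm (coform a (head x))"
      using A1 mnorm_eq_maxnorm [OF assms a] a [OF x] nrm_form [OF x assms, of a] by simp_all
    then obtain b where b: "maxnorm b = 1" "1 \<le> norm (coform b (head x))" "dist a b < \<epsilon>"
      using \<eta> by blast
    \<comment> \<open>Compactness gives only a lower bound; the duality bound turns it into
      equality.\<close>
    have "norm (coform b (head x)) \<le> 1"
      using norm_coform_le [of b "head x"] b(1) sphere_tuplesD(1) [OF x assms] by simp
    with b have "nrm (ell1 1) (form N b x) = 1"
      by (simp only: nrm_form [OF x assms])
    moreover have "mnorm N factors (ell1 1) (form N b - A) = maxnorm (b - a)"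
      by (intro mnorm_eq_maxnorm assms) (simp add: a form_diff [symmetric])
    moreover have "maxnorm (b - a) < \<epsilon>"
      using norm_le_maxnorm_sumnorm(1) [of "b - a"] b(3) by (simp add: dist_norm norm_minus_commute)
    ultimately show "\<exists>B\<in>bdd_multilinear N factors (ell1 1). mnorm N factors (ell1 1) B = 1 \<and>
          nrm (ell1 1) (B x) = 1 \<and> mnorm N factors (ell1 1) (B - A) < \<epsilon>"
      using b(1) mnorm_eq_maxnorm [OF assms refl, of b]
      by (intro bexI [of _ "form N b"] form_bdd_multilinear assms) auto
  qed
qed

lemma Max_less_iff_tuple:
  fixes g :: "nat \<Rightarrow> real"
  assumes "1 \<le> N"
  shows "Max ((\<lambda>j. g j) ` {1..N}) < \<epsilon> \<longleftrightarrow> (\<forall>j\<in>{1..N}. g j < \<epsilon>)"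
  using assms by (subst Max_less_iff) auto

text \<open>The roles are exchanged: the coefficients are fixed and the point of the plane ranges
  over the compact \<open>sumnorm\<close> sphere.\<close>

lemma L_oo_factors:
  assumes "1 \<le> N"
  shows "L_oo N factors (ell1 1 :: ('k::{real_normed_field, heine_borel}, _) nspace)"
  unfolding L_oo_def Max_less_iff_tuple [OF assms]
proof (intro allI ballI impI)
  fix \<epsilon> :: real and A assume "0 < \<epsilon>" and A: "A \<in> bdd_multilinear N factors (ell1 1 :: ('k, _) nspace)"
    and A1: "mnorm N factors (ell1 1) A = 1"
  obtain a where "\<And>x. x \<in> tuples N factors \<Longrightarrow> A x = form N a x"
    by (rule bdd_multilinear_eq_form [OF A assms]) blast
  then have a: "A x = form N a x" if "x \<in> sphere_tuples N factors" for x
    using sphere_tuplesD(3) [OF that assms] by blast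
  have a1: "maxnorm a = 1"
    using A1 mnorm_eq_maxnorm [OF assms a] by simp
  have "continuous_on S (\<lambda>p. norm (coform a p))" for S
    by (auto simp: coform_def intro!: continuous_intros)
  \<comment> \<open>The halved radius pays for the factor 2 between \<open>sumnorm\<close> and the
    product norm.\<close>
  from compact_near_max [OF compact_spheres(2) this, of "\<epsilon> / 2"] \<open>0 < \<epsilon>\<close>
  obtain \<eta> where "0 < \<eta>" and \<eta>: "\<And>p. sumnorm p = 1 \<Longrightarrow> 1 - \<eta> < norm (coform a p) \<Longrightarrow>
      \<exists>q. sumnorm q = 1 \<and> 1 \<le> norm (coform a q) \<and> dist p q < \<epsilon> / 2"
    by auto
  show "\<exists>\<eta>>0. \<forall>x\<in>sphere_tuples N factors. 1 - \<eta> < nrm (ell1 1) (A x) \<longrightarrow>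
      (\<exists>z\<in>sphere_tuples N factors. nrm (ell1 1) (A z) = 1 \<and>
          (\<forall>j\<in>{1..N}. nrm (factors j) (x j - z j) < \<epsilon>))"
  proof (intro exI [of _ \<eta>] conjI ballI impI \<open>0 < \<eta>\<close>)
    fix x assume x: "x \<in> sphere_tuples N factors" and "1 - \<eta> < nrm (ell1 1) (A x)"
    then have "1 - \<eta> < norm (coform a (head x))"
      using a [OF x] nrm_form [OF x assms, of a] by simp
    then obtain q where q: "sumnorm q = 1" "1 \<le> norm (coform a q)" "dist (head x) q < \<epsilon> / 2"
      using \<eta> sphere_tuplesD(1) [OF x assms] by blast
    \<comment> \<open>Only the first slot moves: the scalar entries leave the norm of the value
      unchanged, so they can be kept at distance 0.\<close>
    define z where "z = x(1 := tuple N q 1)"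
    have z: "z \<in> sphere_tuples N factors"
      using tuple_in_sphere_tuples [OF q(1), of N] x assms
      by (auto simp: z_def sphere_tuples_def PiE_iff extensional_def)
    have hz: "head z = q"
      using head_tuple [OF assms, of q] by (simp add: head_def z_def)
    have "norm (coform a q) \<le> 1"
      using norm_coform_le [of a q] a1 q(1) by simp
    then have "nrm (ell1 1) (A z) = 1"
      unfolding a [OF z] nrm_form [OF z assms] hz using q(2) by simp
    moreover have "nrm (factors j) (x j - z j) < \<epsilon>" for j
    proof (cases "j = 1")
      case True
      have "nrm (factors j) (x j - z j) = sumnorm (head x - q)"
        unfolding hz [symmetric] True by (simp add: sumnorm_def head_def)
      also have "\<dots> < \<epsilon>"
        using norm_le_maxnorm_sumnorm(2) [of "head x - q"] q(3) by (simp add: dist_norm)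
      finally show ?thesis .
    qed (use \<open>0 < \<epsilon>\<close> in \<open>simp add: z_def\<close>)
    ultimately show "\<exists>z\<in>sphere_tuples N factors. nrm (ell1 1) (A z) = 1 \<and>
          (\<forall>j\<in>{1..N}. nrm (factors j) (x j - z j) < \<epsilon>)"
      using z by blast
  qed
qed

section \<open>Failure of the uniform properties\<close>

lemma not_BPBpp_factors:
  assumes "1 \<le> N"
  shows "\<not> BPBpp N factors (ell1 1 :: ('k::real_normed_field, _) nspace)"
proof
  assume "BPBpp N factors (ell1 1 :: ('k, _) nspace)"
  from this [unfolded BPBpp_def, rule_format, OF zero_less_one]
  obtain \<eta> where "0 < \<eta>" and \<eta>: "\<And>A x. A \<in> bdd_multilinear N factors (ell1 1 :: ('k, _) nspace) \<Longrightarrow>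
      x \<in> sphere_tuples N factors \<Longrightarrow> mnorm N factors (ell1 1) A = 1 \<Longrightarrow> 1 - \<eta> < nrm (ell1 1) (A x) \<Longrightarrow>
      \<exists>B\<in>bdd_multilinear N factors (ell1 1). mnorm N factors (ell1 1) B = 1 \<and>
          nrm (ell1 1) (B x) = 1 \<and> mnorm N factors (ell1 1) (B - A) < 1"
    by blast
  \<comment> \<open>Halving \<eta> makes \<delta> strictly smaller than it, and the cap 1/2 keeps
    both weights of \<open>p\<close> positive.\<close>
  define \<delta> where "\<delta> = min (1/2) (\<eta>/2)"
  have \<delta>: "0 < \<delta>" "\<delta> < 1" "\<delta> < \<eta>"
    using \<open>0 < \<eta>\<close> by (auto simp: \<delta>_def)
  define p :: "'k \<times> 'k" where "p = (of_real (1 - \<delta>), of_real \<delta>)"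
  have np: "norm (fst p) = 1 - \<delta>" "norm (snd p) = \<delta>"
    unfolding p_def fst_conv snd_conv norm_of_real using \<delta> by auto
  have x: "tuple N p \<in> sphere_tuples N factors"
    by (intro tuple_in_sphere_tuples) (simp add: sumnorm_def np)
  have "nrm (ell1 1) (form N (1, 0) (tuple N p)) = 1 - \<delta>"
    unfolding nrm_form [OF x assms] head_tuple [OF assms] using np(1) by (simp add: coform_def)
  then have val: "1 - \<eta> < nrm (ell1 1) (form N (1, 0) (tuple N p))"
    using \<delta> by simp
  have nrm: "mnorm N factors (ell1 1) (form N (1, 0 :: 'k)) = 1"
    by (subst mnorm_eq_maxnorm [OF assms refl]) (simp add: maxnorm_def)
  obtain B where B: "B \<in> bdd_multilinear N factors (ell1 1 :: ('k, _) nspace)"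
    "mnorm N factors (ell1 1) B = 1" "nrm (ell1 1) (B (tuple N p)) = 1"
    "mnorm N factors (ell1 1) (B - form N (1, 0)) < 1"
    using \<eta> [OF form_bdd_multilinear [OF assms] x nrm val] by blast
  obtain b where "\<And>x. x \<in> tuples N factors \<Longrightarrow> B x = form N b x"
    by (rule bdd_multilinear_eq_form [OF B(1) assms]) blast
  then have b: "B x = form N b x" if "x \<in> sphere_tuples N factors" for x
    using sphere_tuplesD(3) [OF that assms] by blast
  have b1: "norm (fst b) \<le> 1"
    using B(2) mnorm_eq_maxnorm [OF assms b] by (simp add: maxnorm_def)
  \<comment> \<open>The second coefficient of \<open>(1, 0)\<close> is 0, so closeness to this form
    bounds \<open>snd b\<close> itself.\<close>
  have "mnorm N factors (ell1 1) (B - form N (1, 0)) = maxnorm (b - (1, 0))"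
    by (intro mnorm_eq_maxnorm assms) (simp add: b form_diff [symmetric])
  with B(4) have "norm (snd b) < 1"
    by (simp add: maxnorm_def)
  have "1 = norm (coform b p)"
    using B(3) unfolding b [OF x] nrm_form [OF x assms] head_tuple [OF assms] by simp
  also have "\<dots> \<le> norm (fst b) * (1 - \<delta>) + norm (snd b) * \<delta>"
    using norm_coform_triangle [of b p] by (simp only: np)
  \<comment> \<open>Strictness comes from the second summand, where the weight \<delta> is
    positive.\<close>
  also have "\<dots> < 1 * (1 - \<delta>) + 1 * \<delta>"
    using b1 \<open>norm (snd b) < 1\<close> \<delta>
    by (intro add_le_less_mono mult_right_mono mult_strict_right_mono) auto
  finally show False by simp
qed

lemma not_BPBop_factors:
  assumes "1 \<le> N"
  shows "\<not> BPBop N factors (ell1 1 :: ('k::real_normed_field, _) nspace)"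
proof
  assume "BPBop N factors (ell1 1 :: ('k, _) nspace)"
  from this [unfolded BPBop_def Max_less_iff_tuple [OF assms], rule_format, OF zero_less_one]
  obtain \<eta> where "0 < \<eta>" and \<eta>: "\<And>A x. A \<in> bdd_multilinear N factors (ell1 1 :: ('k, _) nspace) \<Longrightarrow>
      x \<in> sphere_tuples N factors \<Longrightarrow> mnorm N factors (ell1 1) A = 1 \<Longrightarrow> 1 - \<eta> < nrm (ell1 1) (A x) \<Longrightarrow>
      \<exists>z\<in>sphere_tuples N factors. nrm (ell1 1) (A z) = 1 \<and>
          (\<forall>j\<in>{1..N}. nrm (factors j) (x j - z j) < 1)"
    by blast
  define \<delta> where "\<delta> = min (1/2) (\<eta>/2)"
  have \<delta>: "0 < \<delta>" "\<delta> < 1" "\<delta> < \<eta>"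
    using \<open>0 < \<eta>\<close> by (auto simp: \<delta>_def)
  \<comment> \<open>The first coefficient fixes the norm at 1; the second falls short of it by less
    than \<eta>.\<close>
  define a :: "'k \<times> 'k" where "a = (1, of_real (1 - \<delta>))"
  have na: "norm (fst a) = 1" "norm (snd a) = 1 - \<delta>"
    unfolding a_def fst_conv snd_conv norm_of_real using \<delta> by auto
  have x: "tuple N (0, 1 :: 'k) \<in> sphere_tuples N factors"
    by (intro tuple_in_sphere_tuples) (simp add: sumnorm_def)
  have "nrm (ell1 1) (form N a (tuple N (0, 1))) = 1 - \<delta>"
    unfolding nrm_form [OF x assms] head_tuple [OF assms] using na(2) by (simp add: coform_def)
  then have val: "1 - \<eta> < nrm (ell1 1) (form N a (tuple N (0, 1)))"
    using \<delta> by simp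
  have nrm: "mnorm N factors (ell1 1) (form N a) = 1"
    using \<delta> by (subst mnorm_eq_maxnorm [OF assms refl]) (simp add: maxnorm_def na)
  obtain z where z: "z \<in> sphere_tuples N factors" "nrm (ell1 1) (form N a z) = 1"
    and dz: "\<forall>j\<in>{1..N}. nrm (factors j) (tuple N (0, 1) j - z j) < 1"
    using \<eta> [OF form_bdd_multilinear [OF assms] x nrm val] by blast
  define q where "q = head z"
  \<comment> \<open>The distance in slot 1 is the sum of the moduli of \<open>fst q\<close> and
    \<open>1 - snd q\<close>; dropping the first keeps the bound.\<close>
  have "norm (1 - snd q) < 1"
    using bspec [OF dz, of 1] assms norm_ge_zero [of "z (Suc 0) 0"]
    by (simp del: norm_ge_zero add: tuple_def q_def head_def)
  then have "snd q \<noteq> 0"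
    by auto
  have "1 = norm (coform a q)"
    using z(2) unfolding nrm_form [OF z(1) assms] q_def by simp
  also have "\<dots> \<le> norm (fst q) + (1 - \<delta>) * norm (snd q)"
    using norm_coform_triangle [of a q] by (simp only: na mult_1)
  \<comment> \<open>A nonzero second coordinate loses a positive amount through its coefficient, so
    norm one is out of reach.\<close>
  also have "\<dots> < norm (fst q) + 1 * norm (snd q)"
    using \<delta> \<open>snd q \<noteq> 0\<close> by (intro add_strict_left_mono mult_strict_right_mono) auto
  also have "\<dots> = 1"
    using sphere_tuplesD(1) [OF z(1) assms] by (simp add: sumnorm_def q_def)
  finally show False by simp
qed

theorem mainTheorem6:
  fixes N :: nat
  assumes "N \<ge> 1"
  shows
    "((\<exists>(X :: nat \<Rightarrow> (real, nat \<Rightarrow> real) nspace) (Y :: (real, nat \<Rightarrow> real) nspace).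
         fd_banach_spaces N X Y \<and> L_pp N X Y \<and> \<not> BPBpp N X Y) \<and>
      (\<exists>(X :: nat \<Rightarrow> (real, nat \<Rightarrow> real) nspace) (Y :: (real, nat \<Rightarrow> real) nspace).
         fd_banach_spaces N X Y \<and> L_oo N X Y \<and> \<not> BPBop N X Y)) \<and>
     ((\<exists>(X :: nat \<Rightarrow> (complex, nat \<Rightarrow> complex) nspace) (Y :: (complex, nat \<Rightarrow> complex) nspace).
         fd_banach_spaces N X Y \<and> L_pp N X Y \<and> \<not> BPBpp N X Y) \<and>
      (\<exists>(X :: nat \<Rightarrow> (complex, nat \<Rightarrow> complex) nspace) (Y :: (complex, nat \<Rightarrow> complex) nspace).
         fd_banach_spaces N X Y \<and> L_oo N X Y \<and> \<not> BPBop N X Y))"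
  \<comment> \<open>The lemmas are generic in the scalar type, so one choice of spaces settles both
    claims over both fields.\<close>
  by (intro conjI exI [of _ factors] exI [of _ "ell1 1"] fd_banach_spaces_factors
      L_pp_factors L_oo_factors not_BPBpp_factors not_BPBop_factors assms)

end
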